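(* Let $k$ be a positive integer. Consider a lattice point $P$ contained in $[0,k]^3$ and a lattice $(3,k)$-triangle $Q$. If $P$ is not contained in $Q$, then $$ d(P,Q)>\varepsilon(3,k). $$
   Context: For positive integers $d$ and $k$, a lattice $(d,k)$-polytope is the convex hull of a finite non-empty subset of $\mathbb{Z}^d\cap[0,k]^d$. A lattice $(3,k)$-triangle is the convex hull of three affinely independent points of $\mathbb{Z}^3\cap[0,k]^3$. A lattice point is a point of $\mathbb{Z}^3$. Distances $d(\cdot,\cdot)$ are Euclidean (minimum distance between points of the two sets; a point is identified with the corresponding singleton). The number $\varepsilon(d,k)$ is the smallest possible value of $d(P',Q')$ over all pairs of disjoint lattice $(d,k)$-polytopes $P'$ and $Q'$. *)

theory Defs
  imports "HOL-Analysis.Analysis"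
begin

definition lattice_points :: "(real ^ 'n) set" where
  "lattice_points = {x. \<forall>i. x $ i \<in> \<int>}"

definition cube :: "nat \<Rightarrow> (real ^ 'n) set" where
  "cube k = {x. \<forall>i. 0 \<le> x $ i \<and> x $ i \<le> real k}"

text \<open>The dimension \<open>d\<close> of a lattice \<open>(d,k)\<close>-polytope is \<open>CARD('n)\<close>.\<close>

definition lattice_polytope :: "nat \<Rightarrow> (real ^ 'n) set \<Rightarrow> bool" where
  "lattice_polytope k P \<longleftrightarrow>
     (\<exists>S. finite S \<and> S \<noteq> {} \<and> S \<subseteq> lattice_points \<inter> cube k \<and> P = convex hull S)"

text \<open>The condition \<open>card S = 3\<close> is needed because \<open>affine_dependent\<close> is a
  predicate on sets: a set with fewer than three points can be affinely independent.\<close>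

definition lattice_triangle :: "nat \<Rightarrow> (real ^ 3) set \<Rightarrow> bool" where
  "lattice_triangle k Q \<longleftrightarrow>
     (\<exists>S. card S = 3 \<and> \<not> affine_dependent S \<and> S \<subseteq> lattice_points \<inter> cube k \<and>
          Q = convex hull S)"

definition polytope_distances :: "'n::finite itself \<Rightarrow> nat \<Rightarrow> real set" where
  "polytope_distances _ k =
     {setdist P Q | P Q :: (real ^ 'n) set.
        lattice_polytope k P \<and> lattice_polytope k Q \<and> P \<inter> Q = {}}"

text \<open>The number \<open>\<epsilon>(d,k)\<close> is \<open>lattice_eps TYPE('n) k\<close> with \<open>d = CARD('n)\<close>. For \<open>k > 0\<close>
  the minimum is over a finite non-empty set, as shown below.\<close>

definition lattice_eps :: "'n::finite itself \<Rightarrow> nat \<Rightarrow> real" where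
  "lattice_eps d k = Min (polytope_distances d k)"

lemma finite_lattice_cube: "finite (lattice_points \<inter> cube k :: (real ^ 'n) set)"
proof -
  have "finite {y::real. y \<in> \<int> \<and> 0 \<le> y \<and> y \<le> real k}"
    by (rule finite_subset[OF _ finite_imageI[of "{0..int k}" of_int]])
       (auto elim!: Ints_cases)
  then have "finite (vec_lambda ` (UNIV \<rightarrow>\<^sub>E {y. y \<in> \<int> \<and> 0 \<le> y \<and> y \<le> real k}) :: (real ^ 'n) set)"
    by (intro finite_imageI finite_PiE) auto
  moreover have "x \<in> vec_lambda ` (UNIV \<rightarrow>\<^sub>E {y. y \<in> \<int> \<and> 0 \<le> y \<and> y \<le> real k})"
    if "x \<in> lattice_points \<inter> cube k" for x :: "real ^ 'n"
    by (rule image_eqI[of _ _ "vec_nth x"])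
       (use that in \<open>auto simp: lattice_points_def cube_def PiE_def\<close>)
  ultimately show ?thesis
    by (rule finite_subset[rotated, OF _ subsetI])
qed

lemma finite_lattice_polytopes: "finite {P :: (real ^ 'n) set. lattice_polytope k P}"
  by (rule finite_subset[OF _ finite_imageI[of "Pow (lattice_points \<inter> cube k)" "\<lambda>S. convex hull S"]])
     (auto simp: lattice_polytope_def finite_lattice_cube simp del: Pow_Int_eq)

lemma finite_polytope_distances: "finite (polytope_distances (d :: 'n::finite itself) k)"
  by (rule finite_subset[OF _ finite_imageI[of
        "{P :: (real ^ 'n) set. lattice_polytope k P} \<times> {P. lattice_polytope k P}"
        "\<lambda>(P, Q). setdist P Q"]])
     (auto simp: polytope_distances_def finite_lattice_polytopes)

lemma polytope_distances_nonempty: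
  assumes "k > 0"
  shows "polytope_distances (d :: 'n::finite itself) k \<noteq> {}"
proof -
  have "lattice_polytope k {0 :: real ^ 'n}"
    unfolding lattice_polytope_def
    by (rule exI[of _ "{0}"]) (auto simp: lattice_points_def cube_def)
  moreover have "lattice_polytope k {1 :: real ^ 'n}"
    unfolding lattice_polytope_def
    by (rule exI[of _ "{1}"]) (use assms in \<open>auto simp: lattice_points_def cube_def\<close>)
  moreover have "{0 :: real ^ 'n} \<inter> {1} = {}"
    by (simp add: vec_eq_iff)
  ultimately show ?thesis
    unfolding polytope_distances_def by blast
qed

end

theory Submission
  imports Defs
begin

unbundle cross3_syntax

text \<open>
  Write \<open>n\<close> for the cross product of two edge vectors of \<open>Q\<close>. Each coordinate of \<open>n\<close> is twice the
  signed area of a triangle in \<open>[0,k]\<^sup>2\<close>, so \<open>\<bar>n\<bar>\<^sup>2 \<le> 3 k\<^sup>4\<close>. If \<open>P\<close> is not in the plane of \<open>Q\<close>, the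
  distance to that plane is a non-zero integer divided by \<open>\<bar>n\<bar>\<close>; if it is, then \<open>P\<close> is separated from
  \<open>Q\<close> by the line through an edge \<open>e\<close>, and its distance to that line is the norm of a non-zero
  lattice vector divided by \<open>\<bar>e\<bar>\<close>. In both cases \<open>d(P,Q)\<^sup>2 \<ge> 1 / (3 k\<^sup>4)\<close>. On the other hand, two nearly
  diagonal segments of the cube are at distance
  \<open>1 / sqrt (2 (2k\<^sup>2 - 4k + 5) (2k\<^sup>2 - 2k + 1))\<close>, and the expression below the root exceeds \<open>3 k\<^sup>4\<close>.
\<close>

subsection \<open>Lattice vectors and cross products\<close>

lemma lattice_points_diff:
  "x \<in> lattice_points \<Longrightarrow> y \<in> lattice_points \<Longrightarrow> x - y \<in> lattice_points"
  by (auto simp: lattice_points_def)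

lemma lattice_points_cross3:
  "x \<in> lattice_points \<Longrightarrow> y \<in> lattice_points \<Longrightarrow> x \<times> y \<in> lattice_points"
  by (auto simp: lattice_points_def forall_3 cross_components)

lemma lattice_points_inner:
  "x \<in> lattice_points \<Longrightarrow> y \<in> lattice_points \<Longrightarrow> x \<bullet> y \<in> \<int>"
  by (auto simp: lattice_points_def inner_vec_def intro!: Ints_sum)

lemma norm_lattice_point_ge_1:
  fixes x :: "real ^ 'n"
  assumes "x \<in> lattice_points" "x \<noteq> 0"
  shows "1 \<le> norm x"
proof -
  obtain i where "x $ i \<noteq> 0"
    using assms(2) by (auto simp: vec_eq_iff)
  then have "1 \<le> \<bar>x $ i\<bar>"
    using assms(1) by (simp add: lattice_points_def Ints_nonzero_abs_ge1)
  then show ?thesis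
    using component_le_norm_cart[of x i] by linarith
qed

lemma norm_cross3_le: "norm (x \<times> y) \<le> norm x * norm y"
proof (rule power2_le_imp_le)
  show "(norm (x \<times> y))\<^sup>2 \<le> (norm x * norm y)\<^sup>2"
    by (simp flip: norm_cross_dot)
qed simp

text \<open>With \<open>n = u \<times> v\<close>, the vectors \<open>v \<times> n\<close>,
  \<open>n \<times> u\<close> and \<open>n\<close> form, up to the factor
  \<open>n \<bullet> n\<close>, the dual basis of \<open>u\<close>, \<open>v\<close>,
  \<open>n\<close>. Expanding \<open>w\<close> in it, orthogonality to \<open>n\<close> removes the
  third term.\<close>

lemma coplanar_cross3:
  assumes "w \<bullet> (u \<times> v) = 0" "u \<times> v \<noteq> 0"
  obtains \<beta> \<gamma> where "w = \<beta> *\<^sub>R u + \<gamma> *\<^sub>R v"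
proof -
  define n where "n = u \<times> v"
  have "(n \<bullet> n) *\<^sub>R w = (w \<bullet> n) *\<^sub>R n + (w \<bullet> (v \<times> n)) *\<^sub>R u + (w \<bullet> (n \<times> u)) *\<^sub>R v"
    unfolding n_def by (simp add: vec_eq_iff forall_3 cross_components inner_vec_def sum_3) algebra
  then have "(n \<bullet> n) *\<^sub>R w = (w \<bullet> (v \<times> n)) *\<^sub>R u + (w \<bullet> (n \<times> u)) *\<^sub>R v"
    using assms by (simp add: n_def)
  moreover have "n \<bullet> n \<noteq> 0"
    using assms by (simp add: n_def)
  moreover have "w = inverse (n \<bullet> n) *\<^sub>R ((n \<bullet> n) *\<^sub>R w)"
    using \<open>n \<bullet> n \<noteq> 0\<close> by simp
  ultimately have "w = inverse (n \<bullet> n) *\<^sub>R ((w \<bullet> (v \<times> n)) *\<^sub>R u + (w \<bullet> (n \<times> u)) *\<^sub>R v)"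
    by simp
  then show thesis
    by (intro that) (simp add: scaleR_add_right)
qed

subsection \<open>Distance from a lattice point to a lattice triangle\<close>

text \<open>This doubled signed area is linear in \<open>a1\<close>, \<open>b1\<close>,
  \<open>c1\<close>, with coefficients that sum to zero. Their positive parts add up to the spread
  of \<open>a2\<close>, \<open>b2\<close>, \<open>c2\<close>, which is at most
  \<open>k\<close>.\<close>

lemma planar_cross_le:
  fixes k :: real
  assumes "0 \<le> a1" "a1 \<le> k" "0 \<le> b1" "b1 \<le> k" "0 \<le> c1" "c1 \<le> k"
    and "0 \<le> a2" "a2 \<le> k" "0 \<le> b2" "b2 \<le> k" "0 \<le> c2" "c2 \<le> k"
  shows "(b1 - a1) * (c2 - a2) - (c1 - a1) * (b2 - a2) \<le> k\<^sup>2"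
proof -
  have *: "x * d \<le> k * max d 0" if "0 \<le> x" "x \<le> k" for x d :: real
    using that by (cases "d \<ge> 0") (auto simp: max_def mult_right_mono mult_nonneg_nonpos)
  have "(b1 - a1) * (c2 - a2) - (c1 - a1) * (b2 - a2)
      = a1 * (b2 - c2) + b1 * (c2 - a2) + c1 * (a2 - b2)"
    by (simp add: algebra_simps)
  also have "\<dots> \<le> k * max (b2 - c2) 0 + k * max (c2 - a2) 0 + k * max (a2 - b2) 0"
    using assms by (intro add_mono *)
  also have "\<dots> = k * (max (b2 - c2) 0 + max (c2 - a2) 0 + max (a2 - b2) 0)"
    by (simp add: algebra_simps)
  also have "\<dots> \<le> k * k"
    using assms by (intro mult_left_mono) (auto simp: max_def)
  finally show ?thesis
    by (simp add: power2_eq_square)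
qed

lemma norm_vec3_le:
  fixes x :: "real ^ 3"
  assumes "\<And>i. \<bar>x $ i\<bar> \<le> m"
  shows "norm x \<le> sqrt 3 * m"
proof -
  have "0 \<le> m"
    using assms[of 1] by linarith
  have "(norm x)\<^sup>2 = (\<Sum>i\<in>UNIV. \<bar>x $ i\<bar>\<^sup>2)"
    unfolding power2_norm_eq_inner inner_vec_def by (simp add: power2_eq_square)
  also have "\<dots> \<le> (\<Sum>i\<in>(UNIV :: 3 set). m\<^sup>2)"
    using assms by (intro sum_mono power_mono) auto
  also have "\<dots> = (sqrt 3 * m)\<^sup>2"
    by (simp add: power_mult_distrib)
  finally show ?thesis
    by (rule power2_le_imp_le) (simp add: \<open>0 \<le> m\<close>)
qed

lemma norm_diff_cube_le:
  fixes a b :: "real ^ 3"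
  assumes "a \<in> cube k" "b \<in> cube k"
  shows "norm (b - a) \<le> sqrt 3 * real k"
proof (rule norm_vec3_le)
  show "\<bar>(b - a) $ i\<bar> \<le> real k" for i
    using assms by (simp add: cube_def abs_le_iff) (smt (verit))
qed

lemma norm_cross3_cube_le:
  assumes "a \<in> cube k" "b \<in> cube k" "c \<in> cube k"
  shows "norm ((b - a) \<times> (c - a)) \<le> sqrt 3 * (real k)\<^sup>2"
proof (rule norm_vec3_le)
  have *: "\<bar>(b $ i - a $ i) * (c $ j - a $ j) - (c $ i - a $ i) * (b $ j - a $ j)\<bar> \<le> (real k)\<^sup>2"
    for i j
  proof -
    note bounds = assms[unfolded cube_def mem_Collect_eq, rule_format]
    show ?thesis
      using planar_cross_le[of "a $ i" "real k" "b $ i" "c $ i" "a $ j" "b $ j" "c $ j"]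
        planar_cross_le[of "a $ i" "real k" "c $ i" "b $ i" "a $ j" "c $ j" "b $ j"]
        bounds by (simp add: abs_le_iff)
  qed
  have "\<forall>i. \<bar>((b - a) \<times> (c - a)) $ i\<bar> \<le> (real k)\<^sup>2"
    using *[of 2 3] *[of 3 1] *[of 1 2] by (simp add: forall_3 cross_components)
  then show "\<bar>((b - a) \<times> (c - a)) $ i\<bar> \<le> (real k)\<^sup>2" for i ..
qed

text \<open>The cross product of \<open>z - b\<close> with \<open>c - b\<close> is a multiple of the
  triangle normal, the factor being minus the barycentric coordinate of \<open>z\<close> at
  \<open>a\<close>. As \<open>\<alpha> < 0 \<le> \<alpha>'\<close>, passing from
  \<open>x - b\<close> to \<open>x - y\<close> can only lengthen this product, and for
  \<open>x - b\<close> it is a non-zero lattice vector.\<close>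

lemma dist_across_edge_ge:
  fixes a b c x y :: "real ^ 3"
  assumes "a \<in> lattice_points" "b \<in> lattice_points" "c \<in> lattice_points" "x \<in> lattice_points"
    and "(b - a) \<times> (c - a) \<noteq> 0"
    and "x = \<alpha> *\<^sub>R a + \<beta> *\<^sub>R b + \<gamma> *\<^sub>R c" "\<alpha> + \<beta> + \<gamma> = 1" "\<alpha> < 0"
    and "y = \<alpha>' *\<^sub>R a + \<beta>' *\<^sub>R b + \<gamma>' *\<^sub>R c" "\<alpha>' + \<beta>' + \<gamma>' = 1" "0 \<le> \<alpha>'"
  shows "1 \<le> dist x y * norm (c - b)"
proof -
  define n where "n = (b - a) \<times> (c - a)"
  have *: "(z - b) \<times> (c - b) = - r *\<^sub>R n"
    if "z = r *\<^sub>R a + s *\<^sub>R b + t *\<^sub>R c" "r + s + t = 1" for z r s t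
  proof -
    have s: "s = 1 - r - t"
      using that(2) by simp
    show ?thesis
      unfolding that(1) n_def s
      by (simp add: vec_eq_iff forall_3 cross_components algebra_simps)
  qed
  have "(x - b) \<times> (c - b) \<noteq> 0"
    using *[OF assms(6,7)] assms(5,8) by (simp add: n_def)
  then have "1 \<le> norm ((x - b) \<times> (c - b))"
    using assms by (intro norm_lattice_point_ge_1 lattice_points_cross3 lattice_points_diff)
  also have "\<dots> = \<bar>\<alpha>\<bar> * norm n"
    by (simp add: *[OF assms(6,7)])
  also have "\<dots> \<le> \<bar>\<alpha>' - \<alpha>\<bar> * norm n"
    using assms by (intro mult_right_mono) auto
  also have "\<dots> = norm (((x - b) - (y - b)) \<times> (c - b))"
    unfolding Cross3.left_diff_distrib[of "x - b"] *[OF assms(6,7)] *[OF assms(9,10)]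
    by (simp flip: scaleR_left_diff_distrib)
  also have "\<dots> \<le> dist x y * norm (c - b)"
    using norm_cross3_le[of "x - y" "c - b"] by (simp add: dist_norm)
  finally show ?thesis .
qed

lemma setdist_lattice_triangle_ge:
  fixes P :: "real ^ 3"
  assumes "k > 0" "P \<in> lattice_points" "lattice_triangle k Q" "P \<notin> Q"
  shows "1 / (sqrt 3 * (real k)\<^sup>2) \<le> setdist {P} Q"
proof -
  obtain S where S: "card S = 3" "\<not> affine_dependent S" "S \<subseteq> lattice_points \<inter> cube k"
      "Q = convex hull S"
    using assms(3) unfolding lattice_triangle_def by blast
  then obtain a b c where abc: "S = {a, b, c}" "a \<noteq> b" "a \<noteq> c" "b \<noteq> c"
    by (auto simp: card_3_iff)
  have Q: "Q = {x *\<^sub>R a + y *\<^sub>R b + z *\<^sub>R c | x y z. 0 \<le> x \<and> 0 \<le> y \<and> 0 \<le> z \<and> x + y + z = 1}"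
    using S abc by (simp add: convex_hull_3)
  have mem: "a \<in> lattice_points" "b \<in> lattice_points" "c \<in> lattice_points"
      "a \<in> cube k" "b \<in> cube k" "c \<in> cube k"
    using S abc by auto
  define n where "n = (b - a) \<times> (c - a)"
  have "\<not> collinear {a, b, c}"
    using S abc by (simp add: collinear_3_eq_affine_dependent)
  \<comment> \<open>\<open>collinear_3\<close> takes differences from the middle point, so
    \<open>a\<close> is moved there.\<close>
  then have "\<not> collinear {b, a, c}"
    by (simp add: insert_commute)
  then have n0: "n \<noteq> 0"
    unfolding n_def cross_eq_0 by (subst (asm) collinear_3) simp
  have edge: "sqrt 3 * real k \<le> sqrt 3 * (real k)\<^sup>2"
    using assms(1) by (simp add: self_le_power)
  have "1 \<le> dist P q * (sqrt 3 * (real k)\<^sup>2)" if "q \<in> Q" for q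
  proof -
    obtain x' y' z' where q: "q = x' *\<^sub>R a + y' *\<^sub>R b + z' *\<^sub>R c"
        "0 \<le> x'" "0 \<le> y'" "0 \<le> z'" "x' + y' + z' = 1"
      using \<open>q \<in> Q\<close> unfolding Q by blast
    consider "(P - a) \<bullet> n \<noteq> 0" | "(P - a) \<bullet> n = 0"
      by blast
    then show ?thesis
    proof cases
      case 1
      have "(P - a) \<bullet> n \<in> \<int>"
        using assms mem unfolding n_def
        by (intro lattice_points_inner lattice_points_cross3 lattice_points_diff)
      then have "1 \<le> \<bar>(P - a) \<bullet> n\<bar>"
        using 1 by (simp add: Ints_nonzero_abs_ge1)
      \<comment> \<open>The last summand vanishes; it makes the identity hold without the constraint
        on the coordinates. The next link of the chain of inequalities is
        \<open>(P - a) \<bullet> n = (P - q) \<bullet> n\<close>, valid because \<open>q\<close>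
        lies in the plane.\<close>
      also have "q - a = y' *\<^sub>R (b - a) + z' *\<^sub>R (c - a) + (x' + y' + z' - 1) *\<^sub>R a"
        unfolding q(1) by (simp add: algebra_simps)
      then have "(q - a) \<bullet> n = 0"
        using q(5) by (simp add: n_def inner_add_left dot_cross_self)
      then have "(P - a) \<bullet> n = (P - q) \<bullet> n"
        by (simp add: inner_diff_left)
      also have "\<bar>(P - q) \<bullet> n\<bar> \<le> dist P q * norm n"
        unfolding dist_norm by (rule Cauchy_Schwarz_ineq2)
      also have "\<dots> \<le> dist P q * (sqrt 3 * (real k)\<^sup>2)"
        unfolding n_def using mem by (intro mult_left_mono norm_cross3_cube_le) auto
      finally show ?thesis .
    next
      case 2
      then obtain \<beta> \<gamma> where "P - a = \<beta> *\<^sub>R (b - a) + \<gamma> *\<^sub>R (c - a)"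
        using coplanar_cross3 n0 unfolding n_def by metis
      then have P: "P = (1 - \<beta> - \<gamma>) *\<^sub>R a + \<beta> *\<^sub>R b + \<gamma> *\<^sub>R c"
        by (simp add: algebra_simps)
      have edge': ?thesis if "1 \<le> dist P q * norm (v - u)" "u \<in> cube k" "v \<in> cube k" for u v :: "real ^ 3"
      proof -
        have "dist P q * norm (v - u) \<le> dist P q * (sqrt 3 * (real k)\<^sup>2)"
          by (rule mult_left_mono[OF order_trans[OF norm_diff_cube_le[OF that(2,3)] edge]]) simp
        with that(1) show ?thesis
          by linarith
      qed
      have "1 - \<beta> - \<gamma> < 0 \<or> \<beta> < 0 \<or> \<gamma> < 0"
      proof (rule ccontr)
        assume "\<not> ?thesis"
        then have "P \<in> Q"
          unfolding Q mem_Collect_eq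
          by (intro exI[of _ "1 - \<beta> - \<gamma>"] exI[of _ \<beta>] exI[of _ \<gamma>]) (use P in auto)
        with assms show False
          by simp
      qed
      then consider "1 - \<beta> - \<gamma> < 0" | "\<beta> < 0" | "\<gamma> < 0"
        by blast
      then show ?thesis
      proof cases
        case 1
        have "1 \<le> dist P q * norm (c - b)"
          by (rule dist_across_edge_ge[OF mem(1-3) assms(2) _ P _ 1 q(1)])
            (use n0 q in \<open>auto simp: n_def\<close>)
        then show ?thesis
          using mem by (intro edge')
      next
        case 2
        \<comment> \<open>A cyclic relabelling of the vertices preserves the normal, so the edge
          argument applies to the edge opposite \<open>b\<close>, and likewise to the one opposite
          \<open>c\<close> below.\<close>
        have "(c - b) \<times> (a - b) = n"
          unfolding n_def by (simp add: vec_eq_iff forall_3 cross_components algebra_simps)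
        moreover have "P = \<beta> *\<^sub>R b + \<gamma> *\<^sub>R c + (1 - \<beta> - \<gamma>) *\<^sub>R a"
          "q = y' *\<^sub>R b + z' *\<^sub>R c + x' *\<^sub>R a"
          by (simp_all add: P q(1) add_ac)
        ultimately have "1 \<le> dist P q * norm (a - c)"
          by (intro dist_across_edge_ge[OF mem(2,3,1) assms(2) _ _ _ 2]) (assumption | use n0 q in simp)+
        then show ?thesis
          using mem by (intro edge')
      next
        case 3
        have "(a - c) \<times> (b - c) = n"
          unfolding n_def by (simp add: vec_eq_iff forall_3 cross_components algebra_simps)
        moreover have "P = \<gamma> *\<^sub>R c + (1 - \<beta> - \<gamma>) *\<^sub>R a + \<beta> *\<^sub>R b"
          "q = z' *\<^sub>R c + x' *\<^sub>R a + y' *\<^sub>R b"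
          by (simp_all add: P q(1) add_ac)
        ultimately have "1 \<le> dist P q * norm (b - a)"
          by (intro dist_across_edge_ge[OF mem(3,1,2) assms(2) _ _ _ 3]) (assumption | use n0 q in simp)+
        then show ?thesis
          using mem by (intro edge')
      qed
    qed
  qed
  then have "1 / (sqrt 3 * (real k)\<^sup>2) \<le> dist P q" if "q \<in> Q" for q
    using that assms(1) by (simp add: pos_divide_le_eq)
  moreover have "Q \<noteq> {}"
    using S abc by simp
  ultimately show ?thesis
    by (intro le_setdistI) auto
qed

subsection \<open>Upper bound on the minimal distance of lattice polytopes\<close>

text \<open>The common perpendicular of the two lines has its feet at parameters
  \<open>s / (n \<bullet> n)\<close> and \<open>t / (n \<bullet> n)\<close>.\<close>

lemma setdist_segments_le:
  fixes a b u v :: "real ^ 3"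
  defines "n \<equiv> u \<times> v" and "w \<equiv> b - a"
  defines "s \<equiv> (w \<bullet> u) * (v \<bullet> v) - (w \<bullet> v) * (u \<bullet> v)"
    and "t \<equiv> (w \<bullet> u) * (u \<bullet> v) - (w \<bullet> v) * (u \<bullet> u)"
  assumes "n \<noteq> 0" "0 \<le> s" "s \<le> n \<bullet> n" "0 \<le> t" "t \<le> n \<bullet> n"
  shows "setdist (closed_segment a (a + u)) (closed_segment b (b + v)) \<le> \<bar>w \<bullet> n\<bar> / norm n"
proof -
  define N where "N = n \<bullet> n"
  define x where "x = a + (s / N) *\<^sub>R u"
  define y where "y = b + (t / N) *\<^sub>R v"
  have N: "N > 0"
    using assms by (simp add: N_def)
  \<comment> \<open>This is the dual basis expansion of \<open>coplanar_cross3\<close>, now for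
    general \<open>w\<close>: the triple products \<open>w \<bullet> (v \<times> n)\<close> and
    \<open>w \<bullet> (n \<times> u)\<close> multiply out to \<open>s\<close> and
    \<open>-t\<close>.\<close>
  have key: "N *\<^sub>R w = (w \<bullet> n) *\<^sub>R n + s *\<^sub>R u - t *\<^sub>R v"
    unfolding N_def n_def s_def t_def
    by (simp add: vec_eq_iff forall_3 cross_components inner_vec_def sum_3) algebra
  have "N *\<^sub>R (y - x) = N *\<^sub>R w + t *\<^sub>R v - s *\<^sub>R u"
    using N by (simp add: x_def y_def w_def algebra_simps)
  then have "N *\<^sub>R (y - x) = (w \<bullet> n) *\<^sub>R n"
    by (simp add: key)
  then have "norm (N *\<^sub>R (y - x)) = norm ((w \<bullet> n) *\<^sub>R n)"
    by simp
  then have "(norm n)\<^sup>2 * dist x y = \<bar>w \<bullet> n\<bar> * norm n"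
    using N by (simp add: dist_norm norm_minus_commute N_def power2_norm_eq_inner)
  then have "dist x y = \<bar>w \<bullet> n\<bar> / norm n"
    using assms(5) by (simp add: field_simps power2_eq_square)
  moreover have "x \<in> closed_segment a (a + u)"
    unfolding in_segment x_def using assms N
    by (intro exI[of _ "s / N"]) (auto simp: N_def algebra_simps)
  moreover have "y \<in> closed_segment b (b + v)"
    unfolding in_segment y_def using assms N
    by (intro exI[of _ "t / N"]) (auto simp: N_def algebra_simps)
  ultimately show ?thesis
    using setdist_le_dist by metis
qed

lemma disjoint_segments:
  fixes a b u v :: "real ^ 3"
  assumes "(b - a) \<bullet> (u \<times> v) \<noteq> 0"
  shows "closed_segment a (a + u) \<inter> closed_segment b (b + v) = {}"
proof (rule ccontr)
  assume "\<not> ?thesis"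
  then obtain s t where "(1 - s) *\<^sub>R a + s *\<^sub>R (a + u) = (1 - t) *\<^sub>R b + t *\<^sub>R (b + v)"
    unfolding closed_segment_def by auto
  then have "b - a = s *\<^sub>R u - t *\<^sub>R v"
    by (simp add: algebra_simps)
  then have "(b - a) \<bullet> (u \<times> v) = 0"
    by (simp add: inner_diff_left dot_cross_self)
  with assms show False ..
qed

lemma lattice_polytope_segment:
  assumes "a \<in> lattice_points \<inter> cube k" "b \<in> lattice_points \<inter> cube k"
  shows "lattice_polytope k (closed_segment a b)"
  unfolding lattice_polytope_def segment_convex_hull using assms
  by (intro exI[of _ "{a, b}"]) auto

lemma lattice_eps_le:
  fixes A B :: "(real ^ 'n) set"
  assumes "lattice_polytope k A" "lattice_polytope k B" "A \<inter> B = {}"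
  shows "lattice_eps TYPE('n) k \<le> setdist A B"
  unfolding lattice_eps_def
  by (rule Min_le[OF finite_polytope_distances]) (use assms in \<open>auto simp: polytope_distances_def\<close>)

text \<open>For lattice segments \<open>w \<bullet> n\<close> is an integer, so absolute value 1 is
  the least one that keeps the two lines disjoint and non-parallel. What remains is to make
  \<open>n\<close> long while both feet of the common perpendicular stay inside the
  segments.\<close>

lemma lattice_eps_le_segments:
  fixes a b u v :: "real ^ 3"
  defines "n \<equiv> u \<times> v" and "w \<equiv> b - a"
  defines "s \<equiv> (w \<bullet> u) * (v \<bullet> v) - (w \<bullet> v) * (u \<bullet> v)"
    and "t \<equiv> (w \<bullet> u) * (u \<bullet> v) - (w \<bullet> v) * (u \<bullet> u)"
  assumes "a \<in> lattice_points \<inter> cube k" "a + u \<in> lattice_points \<inter> cube k"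
    and "b \<in> lattice_points \<inter> cube k" "b + v \<in> lattice_points \<inter> cube k"
    and "\<bar>w \<bullet> n\<bar> = 1" "0 \<le> s" "s \<le> n \<bullet> n" "0 \<le> t" "t \<le> n \<bullet> n"
  shows "lattice_eps TYPE(3) k \<le> 1 / norm n"
proof -
  have "w \<bullet> n \<noteq> 0"
    using assms(9) by auto
  then have "n \<noteq> 0"
    by auto
  have "lattice_eps TYPE(3) k \<le> setdist (closed_segment a (a + u)) (closed_segment b (b + v))"
    using assms(5-8) \<open>w \<bullet> n \<noteq> 0\<close> unfolding w_def n_def
    by (intro lattice_eps_le lattice_polytope_segment disjoint_segments)
  also have "\<dots> \<le> \<bar>w \<bullet> n\<bar> / norm n"
    using setdist_segments_le[of u v b a] assms(10-13) \<open>n \<noteq> 0\<close>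
    unfolding w_def n_def s_def t_def by simp
  finally show ?thesis
    by (simp add: assms(9))
qed

lemma lattice_eps_3_less:
  assumes "k > 0"
  shows "lattice_eps TYPE(3) k < 1 / (sqrt 3 * (real k)\<^sup>2)"
proof -
  have *: "1 / norm n < 1 / (sqrt 3 * (real k)\<^sup>2)" if "3 * (real k) ^ 4 < n \<bullet> n" for n :: "real ^ 3"
  proof (rule divide_strict_left_mono)
    have "(sqrt 3 * (real k)\<^sup>2)\<^sup>2 < (norm n)\<^sup>2"
      using that by (simp add: power_mult_distrib power2_norm_eq_inner)
    then show less: "sqrt 3 * (real k)\<^sup>2 < norm n"
      by (rule power2_less_imp_less) simp
    have "0 < sqrt 3 * (real k)\<^sup>2"
      using assms by simp
    with less show "0 < norm n * (sqrt 3 * (real k)\<^sup>2)"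
      by (metis less_trans mult_pos_pos)
  qed simp
  note vec3 = lattice_points_def cube_def forall_3 vector_3 inner_vec_def sum_3 cross_components
  consider "k = 1" | "k \<ge> 2"
    using assms by linarith
  then show ?thesis
  proof cases
    case 1
    \<comment> \<open>The main diagonal from the origin and the diagonal from (0,0,1) to (0,1,0) of
      a face; here \<open>n \<bullet> n\<close> is 6. The family used for larger \<open>k\<close>
      has an endpoint with second coordinate 2, which leaves the unit cube.\<close>
    define u v b :: "real ^ 3" where "u = vector [1, 1, 1]" and "v = vector [0, 1, -1]"
      and "b = vector [0, 0, 1]"
    have "lattice_eps TYPE(3) k \<le> 1 / norm (u \<times> v)"
      by (rule lattice_eps_le_segments[of 0 k u b v])
        (simp_all add: 1 u_def v_def b_def vec3)
    also have "\<dots> < 1 / (sqrt 3 * (real k)\<^sup>2)"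
      by (rule *) (simp add: 1 u_def v_def vec3)
    finally show ?thesis .
  next
    case 2
    txt \<open>In terms of \<open>x = k - 2\<close> all the polynomials that have to be non-negative have
      non-negative coefficients.\<close>
    then obtain m where m: "k = m + 2"
      by (metis add.commute le_Suc_ex)
    define x where "x = real m"
    have k: "real k = x + 2" and x: "x \<ge> 0"
      by (simp_all add: m x_def)
    have [simp]: "x \<in> \<int>"
      by (simp add: x_def)
    \<comment> \<open>The segments run from the origin to (k-1, k, k) and from (0, k-1, k) to (k, 2,
      1). Their normal is (-2k, 2k^2-2k+1, -2k^2+4k-3), whose product with \<open>b\<close> is -1
      and whose squared norm has leading term 8k^4.\<close>
    define u v b :: "real ^ 3" where "u = vector [x + 1, x + 2, x + 2]"
      and "v = vector [x + 2, 1 - x, - x - 1]" and "b = vector [0, x + 1, x + 2]"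
    have "lattice_eps TYPE(3) k \<le> 1 / norm (u \<times> v)"
    proof (rule lattice_eps_le_segments[of 0 k u b v])
      show "\<bar>(b - 0) \<bullet> (u \<times> v)\<bar> = 1"
        by (simp add: u_def v_def b_def vec3 algebra_simps)
    qed (use x in \<open>simp_all add: k u_def v_def b_def vec3 algebra_simps\<close>)
    also have "\<dots> < 1 / (sqrt 3 * (real k)\<^sup>2)"
      by (rule *) (use x in \<open>auto simp: k u_def v_def vec3 algebra_simps power4_eq_xxxx
        intro!: add_pos_nonneg mult_nonneg_nonneg\<close>)
    finally show ?thesis .
  qed
qed

theorem theorem1p2:
  fixes k :: nat and P :: "real ^ 3" and Q :: "(real ^ 3) set"
  assumes "k > 0"
    and "P \<in> lattice_points" and "P \<in> cube k"
    and "lattice_triangle k Q"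
    and "P \<notin> Q"
  shows "setdist {P} Q > lattice_eps TYPE(3) k"
  using lattice_eps_3_less setdist_lattice_triangle_ge assms by (meson less_le_trans)

end
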